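(* Let $\mathcal{F}$ be a variety of algebras, let $S$ be a finite set, and let $X \subset S^{\mathbb{Z}}$ be an $\mathcal{F}$-subshift. (1) If $X$ is $k$-shallow for some $k \in \mathbb{N}$, then $X$ is cellwise up to algebraic conjugacy, i.e. there exist a cellwise $\mathcal{F}$-subshift $Y$ and an algebraic conjugacy $\phi: X \to Y$. (2) If $X$ is algebraically conjugate to $R^{\mathbb{Z}}$ (with the cellwise structure) for some finite $R \in \mathcal{F}$, then $X$ is $k$-shallow for some $k \in \mathbb{N}$.
   Context: A variety of a given type (a set of operation symbols with finite arities, arity $0$ allowed) is the class of all algebras of that type satisfying a given set of identities. A homomorphism between algebras in $\mathcal{F}$ is called an $\mathcal{F}$-morphism. The shift map on $S^{\mathbb{Z}}$ is $\sigma(x)_i=x_{i+1}$; a subshift is a closed $\sigma$-invariant subset of $S^{\mathbb{Z}}$ for a finite alphabet $S$; a block map is a continuous shift-commuting map between subshifts (for maps $X^n\to X$, $X^n$ carries the product topology and the diagonal shift); a conjugacy is a bijective block map. An $\mathcal{F}$-subshift is a subshift $X\subset S^{\mathbb{Z}}$ equipped with an algebra structure in $\mathcal{F}$ all of whose operations $X^n \to X$ are block maps. If $R \in \mathcal{F}$ is finite, $R^{\mathbb{Z}}$ carries the cellwise structure $f(x^1,\dots,x^n)_i = f(x^1_i,\dots,x^n_i)$; a subshift $Y \subset R^{\mathbb{Z}}$ that is a subalgebra of $R^{\mathbb{Z}}$ is called a cellwise $\mathcal{F}$-subshift. A conjugacy that is also an $\mathcal{F}$-morphism is called algebraic. An affine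 map of an algebra $A$ is a formal expression in a variable $\xi\notin A$ defined inductively as either $t(\xi)=\xi$, or $t(\xi)=a$ for a constant $a\in A$, or $t(\xi)=f(a_1,\dots,a_n)$ where $f$ is an $n$-ary operation, one of the $a_i$ is an affine map and the rest are constants in $A$. $\mathrm{Af}(A)$ is the set of affine maps of $A$, and $\mathrm{Eval}(t):A\to A$ is the function obtained by substituting the argument for $\xi$ and evaluating. The depth of an affine map is the number of nested algebra operations in it (so $\xi$ and constants have depth $0$, and $f(a_1,\dots,a_n)$ has depth one more than its affine-map argument). An algebra $A$ is $k$-shallow if for every $t \in \mathrm{Af}(A)$ there exists $t' \in \mathrm{Af}(A)$ of depth at most $k$ with $\mathrm{Eval}(t) = \mathrm{Eval}(t')$.
   Formalization: Part (1) is proved for types with finitely many operation symbols; for infinite types it fails, e.g. the full shift on two symbols with a unary operation for every power of the shift is 1-shallow but not cellwise up to algebraic conjugacy. *)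

theory Defs
  imports "HOL-Analysis.Analysis"
begin

section \<open>Algebras and varieties\<close>

record 'f signature =
  ops :: "'f set"
  arity :: "'f \<Rightarrow> nat"

record ('f, 'a) algebra =
  universe :: "'a set"
  oper :: "'f \<Rightarrow> 'a list \<Rightarrow> 'a"

text \<open>\<open>tuples A n\<close> is $A^n$; the value of an operation outside the tuples of the correct length
  over the universe is irrelevant. Empty algebras are permitted.\<close>

definition tuples :: "'a set \<Rightarrow> nat \<Rightarrow> 'a list set" where
  "tuples A n = {xs. set xs \<subseteq> A \<and> length xs = n}"

definition algebra_of :: "'f signature \<Rightarrow> ('f, 'a) algebra \<Rightarrow> bool" where
  "algebra_of \<Omega> A \<longleftrightarrow>
    (\<forall>f\<in>ops \<Omega>. \<forall>xs\<in>tuples (universe A) (arity \<Omega> f). oper A f xs \<in> universe A)"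

datatype 'f trm = Var nat | App 'f "'f trm list"

fun wf_trm :: "'f signature \<Rightarrow> 'f trm \<Rightarrow> bool" where
  "wf_trm \<Omega> (Var i) \<longleftrightarrow> True"
| "wf_trm \<Omega> (App f ts) \<longleftrightarrow>
     f \<in> ops \<Omega> \<and> length ts = arity \<Omega> f \<and> (\<forall>t\<in>set ts. wf_trm \<Omega> t)"

fun trm_value :: "('f, 'a) algebra \<Rightarrow> (nat \<Rightarrow> 'a) \<Rightarrow> 'f trm \<Rightarrow> 'a" where
  "trm_value A v (Var i) = v i"
| "trm_value A v (App f ts) = oper A f (map (trm_value A v) ts)"

definition identities :: "'f signature \<Rightarrow> ('f trm \<times> 'f trm) set \<Rightarrow> bool" where
  "identities \<Omega> E \<longleftrightarrow> (\<forall>(l, r)\<in>E. wf_trm \<Omega> l \<and> wf_trm \<Omega> r)"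

text \<open>A variety is represented by its type \<open>\<Omega>\<close> and its identities \<open>E\<close>, so that the same variety
  has members with universes over different HOL types.\<close>

definition variety ::
  "'f signature \<Rightarrow> ('f trm \<times> 'f trm) set \<Rightarrow> ('f, 'a) algebra set" where
  "variety \<Omega> E = {A. algebra_of \<Omega> A \<and>
     (\<forall>(l, r)\<in>E. \<forall>v. range v \<subseteq> universe A \<longrightarrow> trm_value A v l = trm_value A v r)}"

definition morphism ::
  "'f signature \<Rightarrow> ('f, 'a) algebra \<Rightarrow> ('f, 'b) algebra \<Rightarrow> ('a \<Rightarrow> 'b) \<Rightarrow> bool" where
  "morphism \<Omega> A B \<phi> \<longleftrightarrow> \<phi> \<in> universe A \<rightarrow> universe B \<and>
     (\<forall>f\<in>ops \<Omega>. \<forall>xs\<in>tuples (universe A) (arity \<Omega> f). \<phi> (oper A f xs) = oper B f (map \<phi> xs))"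

definition subalgebra :: "'f signature \<Rightarrow> ('f, 'a) algebra \<Rightarrow> 'a set \<Rightarrow> bool" where
  "subalgebra \<Omega> A B \<longleftrightarrow> B \<subseteq> universe A \<and>
     (\<forall>f\<in>ops \<Omega>. \<forall>xs\<in>tuples B (arity \<Omega> f). oper A f xs \<in> B)"


section \<open>Affine maps and shallowness\<close>

text \<open>\<open>Apply f as t bs\<close> is the expression $f(a_1,\dots,a_n)$ whose affine argument \<open>t\<close> stands
  between the constants \<open>as\<close> and \<open>bs\<close>.\<close>

datatype ('f, 'a) affine_map =
    Hole
  | Const 'a
  | Apply 'f "'a list" "('f, 'a) affine_map" "'a list"

inductive_set Af :: "'f signature \<Rightarrow> ('f, 'a) algebra \<Rightarrow> ('f, 'a) affine_map set"
  for \<Omega> :: "'f signature" and A :: "('f, 'a) algebra" where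
  Hole: "Hole \<in> Af \<Omega> A"
| Const: "a \<in> universe A \<Longrightarrow> Const a \<in> Af \<Omega> A"
| Apply: "f \<in> ops \<Omega> \<Longrightarrow> length as + 1 + length bs = arity \<Omega> f \<Longrightarrow>
    set as \<subseteq> universe A \<Longrightarrow> set bs \<subseteq> universe A \<Longrightarrow> t \<in> Af \<Omega> A \<Longrightarrow>
    Apply f as t bs \<in> Af \<Omega> A"

primrec Eval :: "('f, 'a) algebra \<Rightarrow> ('f, 'a) affine_map \<Rightarrow> 'a \<Rightarrow> 'a" where
  "Eval A Hole x = x"
| "Eval A (Const a) x = a"
| "Eval A (Apply f as t bs) x = oper A f (as @ [Eval A t x] @ bs)"

primrec depth :: "('f, 'a) affine_map \<Rightarrow> nat" where
  "depth Hole = 0"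
| "depth (Const a) = 0"
| "depth (Apply f as t bs) = Suc (depth t)"

definition shallow :: "'f signature \<Rightarrow> nat \<Rightarrow> ('f, 'a) algebra \<Rightarrow> bool" where
  "shallow \<Omega> k A \<longleftrightarrow> (\<forall>t\<in>Af \<Omega> A. \<exists>t'\<in>Af \<Omega> A. depth t' \<le> k \<and>
     (\<forall>x\<in>universe A. Eval A t x = Eval A t' x))"


section \<open>Subshifts and block maps\<close>

definition shift_map :: "(int \<Rightarrow> 's) \<Rightarrow> int \<Rightarrow> 's" where
  "shift_map x = (\<lambda>i. x (i + 1))"

definition full_shift :: "'s set \<Rightarrow> (int \<Rightarrow> 's) topology" where
  "full_shift S = product_topology (\<lambda>_. discrete_topology S) UNIV"

text \<open>Invariance is meant for the action of the integers, hence as an equality: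
  mere inclusion of the image in \<open>X\<close> does not imply it, even for closed \<open>X\<close>.\<close>

definition subshift :: "'s set \<Rightarrow> (int \<Rightarrow> 's) set \<Rightarrow> bool" where
  "subshift S X \<longleftrightarrow> finite S \<and> closedin (full_shift S) X \<and> shift_map ` X = X"

definition block_map ::
  "'s set \<Rightarrow> (int \<Rightarrow> 's) set \<Rightarrow> 'r set \<Rightarrow> (int \<Rightarrow> 'r) set \<Rightarrow>
   ((int \<Rightarrow> 's) \<Rightarrow> (int \<Rightarrow> 'r)) \<Rightarrow> bool" where
  "block_map S X R Y \<phi> \<longleftrightarrow>
     continuous_map (subtopology (full_shift S) X) (subtopology (full_shift R) Y) \<phi> \<and>
     (\<forall>x\<in>X. \<phi> (shift_map x) = shift_map (\<phi> x))"

text \<open>Operations take lists, whereas points of the product space are functions on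
  \<open>{..<n}\<close>; \<open>map p [0..<n]\<close> converts between them. For \<open>n = 0\<close> the condition says that
  the constant is a shift-invariant point of \<open>X\<close>.\<close>

definition block_operation ::
  "'s set \<Rightarrow> (int \<Rightarrow> 's) set \<Rightarrow> nat \<Rightarrow> ((int \<Rightarrow> 's) list \<Rightarrow> (int \<Rightarrow> 's)) \<Rightarrow> bool" where
  "block_operation S X n g \<longleftrightarrow>
     continuous_map (product_topology (\<lambda>_. subtopology (full_shift S) X) {..<n})
       (subtopology (full_shift S) X) (\<lambda>p. g (map p [0..<n])) \<and>
     (\<forall>xs\<in>tuples X n. g (map shift_map xs) = shift_map (g xs))"


section \<open>Subshifts with algebraic structure\<close>

definition algebraic_subshift ::
  "'f signature \<Rightarrow> ('f trm \<times> 'f trm) set \<Rightarrow> 's set \<Rightarrow> ('f, int \<Rightarrow> 's) algebra \<Rightarrow> bool" where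
  "algebraic_subshift \<Omega> E S X \<longleftrightarrow>
     subshift S (universe X) \<and> X \<in> variety \<Omega> E \<and>
     (\<forall>f\<in>ops \<Omega>. block_operation S (universe X) (arity \<Omega> f) (oper X f))"

definition cellwise :: "('f, 'r) algebra \<Rightarrow> ('f, int \<Rightarrow> 'r) algebra" where
  "cellwise R = \<lparr>universe = {x. \<forall>i. x i \<in> universe R},
     oper = (\<lambda>f xs i. oper R f (map (\<lambda>x. x i) xs))\<rparr>"

definition cellwise_subshift ::
  "'f signature \<Rightarrow> ('f trm \<times> 'f trm) set \<Rightarrow> ('f, 'r) algebra \<Rightarrow>
   ('f, int \<Rightarrow> 'r) algebra \<Rightarrow> bool" where
  "cellwise_subshift \<Omega> E R Y \<longleftrightarrow>
     R \<in> variety \<Omega> E \<and> finite (universe R) \<and> subshift (universe R) (universe Y) \<and>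
     subalgebra \<Omega> (cellwise R) (universe Y) \<and> oper Y = oper (cellwise R)"

definition algebraic_conjugacy ::
  "'f signature \<Rightarrow> 's set \<Rightarrow> ('f, int \<Rightarrow> 's) algebra \<Rightarrow> 'r set \<Rightarrow> ('f, int \<Rightarrow> 'r) algebra \<Rightarrow>
   ((int \<Rightarrow> 's) \<Rightarrow> (int \<Rightarrow> 'r)) \<Rightarrow> bool" where
  "algebraic_conjugacy \<Omega> S X R Y \<phi> \<longleftrightarrow>
     block_map S (universe X) R (universe Y) \<phi> \<and>
     bij_betw \<phi> (universe X) (universe Y) \<and> morphism \<Omega> X Y \<phi>"

text \<open>The alphabet is taken inside \<open>nat\<close> because every finite alphabet can be renamed so.\<close>

definition cellwise_up_to_conjugacy ::
  "'f signature \<Rightarrow> ('f trm \<times> 'f trm) set \<Rightarrow> 's set \<Rightarrow> ('f, int \<Rightarrow> 's) algebra \<Rightarrow> bool" where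
  "cellwise_up_to_conjugacy \<Omega> E S X \<longleftrightarrow>
     (\<exists>(R :: ('f, nat) algebra) Y \<phi>.
        cellwise_subshift \<Omega> E R Y \<and> algebraic_conjugacy \<Omega> S X (universe R) Y \<phi>)"

text \<open>Pitfall: finiteness of the alphabet does not bound the radii of infinitely many operations.
  The full shift on two symbols with one unary operation for each power of the shift is 1-shallow,
  yet it is not cellwise up to algebraic conjugacy: in a cellwise algebra each unary operation
  sees only the cell it writes, so a configuration would be determined by its central symbol.
  Passing from shallowness to a cellwise structure therefore needs \<open>finite (ops \<Omega>)\<close>.\<close>

end

theory Submission
  imports Defs
begin

text \<open>The two directions have separate reasons.

\<^emph>\<open>Shallow implies cellwise.\<close> The point is to find a finite quotient of the algebra \<open>X\<close> that
remembers the central symbol. Declare two points equivalent if every affine map sends them to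
points with the same symbol at \<open>0\<close>. Composing an affine map with a further operation gives an
affine map again, so this is a congruence; the affine map \<open>\<xi>\<close> itself shows that equivalent points
have the same central symbol (\<open>profile_compatible\<close>). By compactness every operation is uniformly
continuous, and finitely many operations share a modulus; hence all affine maps of depth at most
\<open>k\<close>, whatever their constants, have a common modulus (\<open>bounded_depth_uniform\<close>). Shallowness extends
this to all affine maps: a fixed central window determines the class of a point, so the
quotient \<open>R\<close> is finite. As a surjective image of \<open>X\<close> it lies in the variety. The map \<open>\<phi>\<close> that records
at cell \<open>i\<close> the class of the \<open>i\<close>-th shift of the point is an algebraic conjugacy onto a cellwise
subshift over \<open>R\<close>: it is a morphism because operations commute with shifts, and injective because
the class determines the central symbol (\<open>cellwise_if_compatible_code\<close>).

\<^emph>\<open>Full cellwise shifts are shallow.\<close> Forget the constants of an affine map and keep its skeleton: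
the operation symbols and the argument positions. In \<open>R\<^sup>\<int>\<close> an affine map is the same as a family,
indexed by the cells, of affine maps of \<open>R\<close> with a common skeleton, because the constants can be
prescribed independently at each cell (\<open>affine_map_of_cells\<close>). So the functions realised by a
skeleton over \<open>R\<^sup>\<int>\<close> depend only on the set of functions \<open>R \<rightarrow> R\<close> that it realises over \<open>R\<close>. There
are finitely many such sets; take one skeleton for each, and let \<open>k\<close> be the largest depth
(\<open>cellwise_shallow\<close>). Shallowness is invariant under isomorphism (\<open>shallow_if_isomorphic\<close>).\<close>

section \<open>Morphisms acting on terms and affine maps\<close>

lemma tuples_map: "h \<in> A \<rightarrow> B \<Longrightarrow> xs \<in> tuples A n \<Longrightarrow> map h xs \<in> tuples B n"
  by (auto simp: tuples_def)

lemma operation_in_universe: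
  "algebra_of \<Omega> A \<Longrightarrow> f \<in> ops \<Omega> \<Longrightarrow> xs \<in> tuples (universe A) (arity \<Omega> f) \<Longrightarrow>
   oper A f xs \<in> universe A"
  by (auto simp: algebra_of_def)

lemma trm_value_in_universe:
  assumes "algebra_of \<Omega> A" "range v \<subseteq> universe A" "wf_trm \<Omega> t"
  shows "trm_value A v t \<in> universe A"
  using assms(3)
proof (induction t)
  case (Var i)
  then show ?case using assms(2) by auto
next
  case (App f ts)
  then have "map (trm_value A v) ts \<in> tuples (universe A) (arity \<Omega> f)"
    by (auto simp: tuples_def)
  then show ?case using App.prems operation_in_universe[OF assms(1)] by simp
qed

lemma trm_value_morphism:
  assumes "algebra_of \<Omega> A" "morphism \<Omega> A B h" "range v \<subseteq> universe A" "wf_trm \<Omega> t"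
  shows "h (trm_value A v t) = trm_value B (h \<circ> v) t"
  using assms(4)
proof (induction t)
  case (Var i)
  then show ?case by simp
next
  case (App f ts)
  then have "map (trm_value A v) ts \<in> tuples (universe A) (arity \<Omega> f)"
    using trm_value_in_universe[OF assms(1,3)] by (auto simp: tuples_def)
  then have "h (trm_value A v (App f ts)) = oper B f (map h (map (trm_value A v) ts))"
    using assms(2) App.prems by (auto simp: morphism_def)
  also have "map h (map (trm_value A v) ts) = map (trm_value B (h \<circ> v)) ts"
    using App by (auto simp: comp_def)
  finally show ?case by (simp add: comp_def)
qed

text \<open>Every valuation in the image lifts to the source, where the identity holds, and the morphism
carries the two equal values back.\<close>

lemma variety_surjective_image:
  assumes "identities \<Omega> E" "A \<in> variety \<Omega> E" "morphism \<Omega> A B h" "h ` universe A = universe B"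
  shows "B \<in> variety \<Omega> E"
proof -
  have alg: "algebra_of \<Omega> A" using assms(2) by (simp add: variety_def)
  define g where "g = inv_into (universe A) h"
  have g: "g b \<in> universe A" "h (g b) = b" if "b \<in> universe B" for b
    using that assms(4) by (auto simp: g_def inv_into_into f_inv_into_f)
  have "oper B f ys \<in> universe B" if f: "f \<in> ops \<Omega>" and ys: "ys \<in> tuples (universe B) (arity \<Omega> f)" for f ys
  proof -
    have gys: "map g ys \<in> tuples (universe A) (arity \<Omega> f)"
      using ys g by (auto simp: tuples_def)
    have "map h (map g ys) = ys"
      using ys g by (auto simp: tuples_def intro!: map_idI)
    then have "h (oper A f (map g ys)) = oper B f ys"
      using assms(3) f gys unfolding morphism_def by metis
    then show ?thesis
      using imageI[OF operation_in_universe[OF alg f gys], of h] assms(4) by simp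
  qed
  then have "algebra_of \<Omega> B" by (auto simp: algebra_of_def)
  moreover have "trm_value B v l = trm_value B v r"
    if lr: "(l, r) \<in> E" and v: "range v \<subseteq> universe B" for l r v
  proof -
    have w: "range (g \<circ> v) \<subseteq> universe A" and hw: "h \<circ> (g \<circ> v) = v"
      using v g by (auto simp: fun_eq_iff image_subset_iff)
    have "wf_trm \<Omega> l" "wf_trm \<Omega> r" using assms(1) lr by (auto simp: identities_def)
    moreover have "trm_value A (g \<circ> v) l = trm_value A (g \<circ> v) r"
      using assms(2) lr w by (auto simp: variety_def)
    ultimately show ?thesis
      using trm_value_morphism[OF alg assms(3) w] hw by metis
  qed
  ultimately show ?thesis by (auto simp: variety_def)
qed

lemma Eval_in_universe:
  assumes "algebra_of \<Omega> A" "t \<in> Af \<Omega> A" "x \<in> universe A"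
  shows "Eval A t x \<in> universe A"
  using assms(2)
proof induction
  case (Apply f as bs t)
  then show ?case
    by (auto intro!: operation_in_universe[OF assms(1)] simp: tuples_def)
qed (use assms(3) in auto)

lemma depth_map_affine_map [simp]: "depth (map_affine_map g h t) = depth t"
  by (induction t) auto

lemma Af_map:
  assumes "h \<in> universe A \<rightarrow> universe B" "t \<in> Af \<Omega> A"
  shows "map_affine_map id h t \<in> Af \<Omega> B"
  using assms(2)
  by induction (use assms(1) in \<open>auto intro!: Af.intros simp: Pi_iff subset_iff\<close>)

text \<open>Used both to transport affine maps along isomorphisms and, with the projection to a cell as the
morphism, to read an affine map of the full shift cell by cell.\<close>

lemma Eval_map:
  assumes "algebra_of \<Omega> A" "morphism \<Omega> A B h" "t \<in> Af \<Omega> A" "x \<in> universe A"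
  shows "Eval B (map_affine_map id h t) (h x) = h (Eval A t x)"
  using assms(3)
proof induction
  case (Apply f as bs t)
  have "as @ [Eval A t x] @ bs \<in> tuples (universe A) (arity \<Omega> f)"
    using Apply Eval_in_universe[OF assms(1) _ assms(4)] by (auto simp: tuples_def)
  then have "h (oper A f (as @ [Eval A t x] @ bs)) = oper B f (map h (as @ [Eval A t x] @ bs))"
    using assms(2) Apply.hyps unfolding morphism_def by blast
  then show ?case using Apply.IH by simp
qed auto

lemma morphism_inv_into:
  assumes "algebra_of \<Omega> A" "morphism \<Omega> A B h" "bij_betw h (universe A) (universe B)"
  shows "morphism \<Omega> B A (inv_into (universe A) h)"
proof -
  define g where "g = inv_into (universe A) h"
  have g: "g b \<in> universe A" "h (g b) = b" if "b \<in> universe B" for b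
    using that assms(3) by (auto simp: g_def bij_betw_def inv_into_into f_inv_into_f)
  have gh: "g (h a) = a" if "a \<in> universe A" for a
    using that assms(3) by (auto simp: g_def bij_betw_def)
  have "g (oper B f ys) = oper A f (map g ys)"
    if f: "f \<in> ops \<Omega>" and ys: "ys \<in> tuples (universe B) (arity \<Omega> f)" for f ys
  proof -
    have gys: "map g ys \<in> tuples (universe A) (arity \<Omega> f)"
      using ys g by (auto simp: tuples_def)
    have "map h (map g ys) = ys"
      using ys g by (auto simp: tuples_def intro!: map_idI)
    then have "h (oper A f (map g ys)) = oper B f ys"
      using assms(2) f gys unfolding morphism_def by metis
    then show ?thesis
      using operation_in_universe[OF assms(1) f gys] gh by metis
  qed
  then show ?thesis using g unfolding morphism_def g_def[symmetric] by auto
qed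

lemma shallow_if_isomorphic:
  assumes A: "algebra_of \<Omega> A" and B: "algebra_of \<Omega> B"
    and h: "morphism \<Omega> A B h" and bij: "bij_betw h (universe A) (universe B)"
    and k: "shallow \<Omega> k B"
  shows "shallow \<Omega> k A"
  unfolding shallow_def
proof
  fix t assume t: "t \<in> Af \<Omega> A"
  define g where "g = inv_into (universe A) h"
  have g: "morphism \<Omega> B A g" unfolding g_def by (rule morphism_inv_into[OF A h bij])
  have gh: "g (h a) = a" if "a \<in> universe A" for a
    using that bij by (auto simp: g_def bij_betw_def)
  have hU: "h \<in> universe A \<rightarrow> universe B" and gU: "g \<in> universe B \<rightarrow> universe A"
    using g h by (auto simp: morphism_def)
  obtain u where u: "u \<in> Af \<Omega> B" "depth u \<le> k"
    "\<And>y. y \<in> universe B \<Longrightarrow> Eval B (map_affine_map id h t) y = Eval B u y"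
    using k Af_map[OF hU t] unfolding shallow_def by blast
  have "Eval A t x = Eval A (map_affine_map id g u) x" if x: "x \<in> universe A" for x
  proof -
    have hx: "h x \<in> universe B" using x hU by auto
    have "Eval A (map_affine_map id g u) x = g (Eval B u (h x))"
      using Eval_map[OF B g u(1) hx] gh[OF x] by simp
    also have "\<dots> = g (h (Eval A t x))"
      using u(3)[OF hx] Eval_map[OF A h t x] by simp
    also have "\<dots> = Eval A t x" by (rule gh[OF Eval_in_universe[OF A t x]])
    finally show ?thesis by simp
  qed
  then show "\<exists>t'\<in>Af \<Omega> A. depth t' \<le> k \<and> (\<forall>x\<in>universe A. Eval A t x = Eval A t' x)"
    using Af_map[OF gU u(1)] u(2) by (intro bexI[of _ "map_affine_map id g u"]) auto
qed

section \<open>Full shifts over finite algebras are shallow\<close>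

definition skeleton :: "('f, 'a) affine_map \<Rightarrow> ('f, unit) affine_map" where
  "skeleton t = map_affine_map id (\<lambda>_. ()) t"

lemma depth_skeleton [simp]: "depth (skeleton t) = depth t"
  by (simp add: skeleton_def)

text \<open>The functions are restricted to the universe so that over a finite algebra there are
only finitely many of them.\<close>

definition realised ::
  "'f signature \<Rightarrow> ('f, 'a) algebra \<Rightarrow> ('f, unit) affine_map \<Rightarrow> ('a \<Rightarrow> 'a) set" where
  "realised \<Omega> R s = (\<lambda>u. restrict (Eval R u) (universe R)) ` {u \<in> Af \<Omega> R. skeleton u = s}"

lemma algebra_of_cellwise:
  assumes "algebra_of \<Omega> R" shows "algebra_of \<Omega> (cellwise R)"
  unfolding algebra_of_def
proof (intro ballI)
  fix f xs assume "f \<in> ops \<Omega>" "xs \<in> tuples (universe (cellwise R)) (arity \<Omega> f)"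
  then have "map (\<lambda>x. x i) xs \<in> tuples (universe R) (arity \<Omega> f)" for i
    by (auto simp: tuples_def cellwise_def)
  then show "oper (cellwise R) f xs \<in> universe (cellwise R)"
    using assms \<open>f \<in> ops \<Omega>\<close> by (auto simp: cellwise_def algebra_of_def)
qed

lemma morphism_cell: "morphism \<Omega> (cellwise R) R (\<lambda>x. x i)"
  by (auto simp: morphism_def cellwise_def)

lemma list_of_cells:
  fixes xs :: "int \<Rightarrow> 'a list"
  assumes "\<And>i. length (xs i) = n" "\<And>i. set (xs i) \<subseteq> A"
  shows "\<exists>ys. length ys = n \<and> set ys \<subseteq> {y. \<forall>i. y i \<in> A} \<and> (\<forall>i. map (\<lambda>y. y i) ys = xs i)"
proof -
  have "map (\<lambda>y. y i) (map (\<lambda>j i. xs i ! j) [0..<n]) = xs i" for i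
    using assms(1) by (auto intro: nth_equalityI)
  moreover have "xs i ! j \<in> A" if "j < n" for i j
    using that assms(1)[of i] assms(2)[of i] nth_mem[of j "xs i"] by auto
  ultimately show ?thesis
    by (intro exI[of _ "map (\<lambda>j i. xs i ! j) [0..<n]"]) auto
qed

text \<open>This is where the whole of \<open>R\<^sup>\<int>\<close> is used: in a proper subshift the constants of different cells
constrain each other, and a family of constants need not be a point of the subshift.\<close>

lemma affine_map_of_cells:
  assumes "\<And>i. u i \<in> Af \<Omega> R" "\<And>i. skeleton (u i) = s"
  shows "\<exists>t\<in>Af \<Omega> (cellwise R). skeleton t = s \<and> (\<forall>i::int. map_affine_map id (\<lambda>x. x i) t = u i)"
  using assms
proof (induction s arbitrary: u)
  case Hole
  then have "u i = Hole" for i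
    using Hole(2)[of i] by (cases "u i") (auto simp: skeleton_def)
  then show ?case by (intro bexI[of _ Hole]) (auto simp: skeleton_def intro: Af.intros)
next
  case (Const c)
  then have "\<exists>a. u i = Const a" for i
    using Const(2)[of i] by (cases "u i") (auto simp: skeleton_def)
  then obtain a where a: "u i = Const (a i)" for i by metis
  have "a i \<in> universe R" for i
    using Const(1)[of i] a[of i] by (auto elim: Af.cases)
  then show ?case using a
    by (intro bexI[of _ "Const a"]) (auto simp: skeleton_def cellwise_def intro!: Af.intros)
next
  case (Apply f cs s ds)
  have "\<exists>as v bs. u i = Apply f as v bs \<and> length as = length cs \<and> length bs = length ds
      \<and> skeleton v = s" for i
    using Apply(3)[of i] by (cases "u i") (auto simp: skeleton_def)
  then obtain as v bs where u: "u i = Apply f (as i) (v i) (bs i)"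
    "length (as i) = length cs" "length (bs i) = length ds" "skeleton (v i) = s" for i
    by metis
  have inv: "f \<in> ops \<Omega> \<and> length cs + 1 + length ds = arity \<Omega> f \<and> set (as i) \<subseteq> universe R \<and>
     set (bs i) \<subseteq> universe R \<and> v i \<in> Af \<Omega> R" for i
    using Apply(2)[of i] u[of i] by (auto elim: Af.cases)
  obtain t where t: "t \<in> Af \<Omega> (cellwise R)" "skeleton t = s"
    "map_affine_map id (\<lambda>x. x i) t = v i" for i
    using Apply.IH[of v] inv u(4) by blast
  obtain as' where as': "length as' = length cs" "set as' \<subseteq> universe (cellwise R)"
    "map (\<lambda>y. y i) as' = as i" for i
    using list_of_cells[of as "length cs" "universe R"] inv u(2) by (auto simp: cellwise_def)
  obtain bs' where bs': "length bs' = length ds" "set bs' \<subseteq> universe (cellwise R)"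
    "map (\<lambda>y. y i) bs' = bs i" for i
    using list_of_cells[of bs "length ds" "universe R"] inv u(3) by (auto simp: cellwise_def)
  have unit: "map (\<lambda>_. ()) xs = ys" if "length xs = length ys" for xs :: "(int \<Rightarrow> 'b) list" and ys
    using that by (auto intro: nth_equalityI)
  have "Apply f as' t bs' \<in> Af \<Omega> (cellwise R)"
    using inv t as' bs' by (intro Af.Apply) auto
  then show ?case using t as' bs' u unit
    by (intro bexI[of _ "Apply f as' t bs'"]) (auto simp: skeleton_def id_def)
qed

lemma finite_range_realised:
  assumes "algebra_of \<Omega> R" "finite (universe R)"
  shows "finite (range (realised \<Omega> R))"
proof (rule finite_subset)
  have "restrict (Eval R u) (universe R) \<in> universe R \<rightarrow>\<^sub>E universe R" if "u \<in> Af \<Omega> R" for u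
    using Eval_in_universe[OF assms(1) that] by auto
  then show "range (realised \<Omega> R) \<subseteq> Pow (universe R \<rightarrow>\<^sub>E universe R)"
    unfolding realised_def by blast
  show "finite (Pow (universe R \<rightarrow>\<^sub>E universe R))"
    using assms(2) by (simp add: finite_PiE)
qed

lemma cellwise_shallow:
  assumes alg: "algebra_of \<Omega> R" and fin: "finite (universe R)"
  shows "\<exists>k. shallow \<Omega> k (cellwise R)"
proof -
  define F where "F = realised \<Omega> R"
  define k where "k = Max (depth ` inv F ` range F)"
  have "finite (depth ` inv F ` range F)"
    using finite_range_realised[OF assms] by (simp add: F_def)
  then have k: "depth (inv F (F s)) \<le> k" for s
    unfolding k_def by (intro Max_ge) auto
  have "shallow \<Omega> k (cellwise R)"
    unfolding shallow_def
  proof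
    fix t assume t: "t \<in> Af \<Omega> (cellwise R)"
    let ?cell = "\<lambda>i. map_affine_map id (\<lambda>x. x i)"
    \<comment> \<open>the chosen skeleton that realises the same functions as the skeleton of \<open>t\<close>\<close>
    define s where "s = inv F (F (skeleton t))"
    have Fs: "F s = F (skeleton t)" by (simp add: s_def f_inv_into_f)
    have cell: "?cell i t \<in> Af \<Omega> R" for i
      by (rule Af_map[OF _ t]) (auto simp: cellwise_def)
    have "skeleton (?cell i t) = skeleton t" for i
      by (simp add: skeleton_def affine_map.map_comp comp_def id_def)
    then have "restrict (Eval R (?cell i t)) (universe R) \<in> F s" for i
      using cell[of i] unfolding Fs unfolding F_def realised_def by blast
    then have "\<exists>u. u \<in> Af \<Omega> R \<and> skeleton u = s \<and>
        restrict (Eval R (?cell i t)) (universe R) = restrict (Eval R u) (universe R)" for i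
      unfolding F_def realised_def image_def by blast
    then have "\<forall>i. \<exists>u. u \<in> Af \<Omega> R \<and> skeleton u = s \<and>
        restrict (Eval R (?cell i t)) (universe R) = restrict (Eval R u) (universe R)" by blast
    from choice[OF this] obtain u where u: "u i \<in> Af \<Omega> R" "skeleton (u i) = s"
      "restrict (Eval R (?cell i t)) (universe R) = restrict (Eval R (u i)) (universe R)" for i
      by blast
    obtain t' where t': "t' \<in> Af \<Omega> (cellwise R)" "skeleton t' = s" "?cell i t' = u i" for i
      using affine_map_of_cells[of u \<Omega> R s] u by blast
    have "Eval (cellwise R) t x = Eval (cellwise R) t' x" if x: "x \<in> universe (cellwise R)" for x
    proof
      fix i
      have xi: "x i \<in> universe R" using x by (simp add: cellwise_def)
      note E = Eval_map[OF algebra_of_cellwise[OF alg] morphism_cell _ x]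
      have "Eval (cellwise R) t x i = Eval R (?cell i t) (x i)" using E[OF t] by simp
      also have "\<dots> = Eval R (u i) (x i)" using fun_cong[OF u(3)[of i], of "x i"] xi by simp
      also have "\<dots> = Eval (cellwise R) t' x i" using E[OF t'(1), of i] t'(3) by simp
      finally show "Eval (cellwise R) t x i = Eval (cellwise R) t' x i" .
    qed
    moreover have "depth t' \<le> k"
      using k[of "skeleton t"] t'(2) depth_skeleton[of t'] by (simp add: s_def)
    ultimately show "\<exists>t'\<in>Af \<Omega> (cellwise R). depth t' \<le> k \<and>
        (\<forall>x\<in>universe (cellwise R). Eval (cellwise R) t x = Eval (cellwise R) t' x)"
      using t'(1) by auto
  qed
  then show ?thesis ..
qed

section \<open>Central windows and uniform continuity\<close>

definition agree :: "nat \<Rightarrow> (int \<Rightarrow> 's) \<Rightarrow> (int \<Rightarrow> 's) \<Rightarrow> bool" where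
  "agree m x y \<longleftrightarrow> (\<forall>i. \<bar>i\<bar> \<le> int m \<longrightarrow> x i = y i)"

lemma agree_refl [simp]: "agree m x x"
  by (simp add: agree_def)

lemma agree_sym: "agree m x y \<Longrightarrow> agree m y x"
  by (simp add: agree_def)

lemma agree_trans: "agree m x y \<Longrightarrow> agree m y z \<Longrightarrow> agree m x z"
  by (simp add: agree_def)

lemma agree_mono: "agree m x y \<Longrightarrow> n \<le> m \<Longrightarrow> agree n x y"
  by (auto simp: agree_def)

lemma subshift_values: "subshift S X \<Longrightarrow> x \<in> X \<Longrightarrow> x i \<in> S"
  by (auto simp: subshift_def full_shift_def PiE_iff dest!: closedin_subset)

lemma topspace_subshift: "subshift S X \<Longrightarrow> topspace (subtopology (full_shift S) X) = X"
  using subshift_values[of S X] by (auto simp: full_shift_def)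

lemma compact_space_subshift:
  assumes "subshift S X" shows "compact_space (subtopology (full_shift S) X)"
proof -
  have "compact_space (full_shift S)"
    using assms by (simp add: full_shift_def subshift_def compact_space_product_topology
        compact_space_discrete_topology)
  then show ?thesis
    using assms by (simp add: subshift_def closedin_compact_space compact_space_subtopology)
qed

lemma finite_int_bounded: "finite (I :: int set) \<Longrightarrow> \<exists>m. \<forall>i\<in>I. \<bar>i\<bar> \<le> int m"
proof (induction rule: finite_induct)
  case (insert j I)
  then obtain m where "\<forall>i\<in>I. \<bar>i\<bar> \<le> int m" by auto
  then show ?case by (intro exI[of _ "m + nat \<bar>j\<bar>"]) auto
qed auto

lemma open_contains_window:
  assumes X: "subshift S X" and V: "openin (subtopology (full_shift S) X) V" and x: "x \<in> V"
  shows "\<exists>m. \<forall>y\<in>X. agree m x y \<longrightarrow> y \<in> V"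
proof -
  obtain T where T: "openin (full_shift S) T" "V = T \<inter> X"
    using V by (auto simp: openin_subtopology)
  then obtain U where U: "finite {i. U i \<noteq> S}" "x \<in> PiE UNIV U" "PiE UNIV U \<subseteq> T"
    using x by (auto simp: full_shift_def openin_product_topology_alt)
  obtain m where m: "\<And>i. U i \<noteq> S \<Longrightarrow> \<bar>i\<bar> \<le> int m"
    using finite_int_bounded[OF U(1)] by auto
  have "y \<in> V" if y: "y \<in> X" "agree m x y" for y
  proof -
    have "y i \<in> U i" for i
    proof (cases "U i = S")
      case True
      then show ?thesis using subshift_values[OF X y(1)] by simp
    next
      case False
      then have "y i = x i" using m[of i] y(2) by (simp add: agree_def)
      then show ?thesis using U(2) by auto
    qed
    then show ?thesis using U(3) T(2) y(1) by auto
  qed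
  then show ?thesis by blast
qed

lemma window_open:
  assumes X: "subshift S X" and x: "x \<in> X"
  shows "openin (subtopology (full_shift S) X) {y \<in> X. agree m x y}"
proof -
  define U where "U = (\<lambda>i. if \<bar>i\<bar> \<le> int m then {x i} else S)"
  have "{i. U i \<noteq> S} \<subseteq> {- int m..int m}" by (auto simp: U_def)
  then have "finite {i. U i \<noteq> S}" by (rule finite_subset) simp
  moreover have "\<And>i. U i \<subseteq> S" using subshift_values[OF X x] by (auto simp: U_def)
  ultimately have "openin (full_shift S) (PiE UNIV U)"
    by (auto simp: full_shift_def openin_PiE_gen)
  moreover have "{y \<in> X. agree m x y} = PiE UNIV U \<inter> X"
    using subshift_values[OF X] by (auto simp: U_def agree_def PiE_iff split: if_splits)
  ultimately show ?thesis by (auto simp: openin_subtopology)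
qed

text \<open>The converse of the uniform continuity below, for maps into a discrete space.\<close>

lemma continuous_map_window_determined:
  assumes X: "subshift S X" and h: "h \<in> X \<rightarrow> D"
    and m: "\<And>x y. x \<in> X \<Longrightarrow> y \<in> X \<Longrightarrow> agree m x y \<Longrightarrow> h x = h y"
  shows "continuous_map (subtopology (full_shift S) X) (discrete_topology D) h"
proof -
  have "openin (subtopology (full_shift S) X) {x \<in> X. h x \<in> U}" for U
  proof (subst openin_subopen, intro ballI)
    fix x assume x: "x \<in> {x \<in> X. h x \<in> U}"
    then have "h y \<in> U" if "y \<in> X" "agree m x y" for y
      using m[of x y] that by simp
    then show "\<exists>T. openin (subtopology (full_shift S) X) T \<and> x \<in> T \<and> T \<subseteq> {x \<in> X. h x \<in> U}"
      using window_open[OF X] x by (intro exI[of _ "{y \<in> X. agree m x y}"]) auto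
  qed
  then show ?thesis
    using h unfolding continuous_map_def topspace_subshift[OF X] by auto
qed

text \<open>Heine--Cantor for the clopen equivalence relations \<open>agree\<close>: continuity gives every tuple \<open>p\<close> a window
\<open>m p\<close> that controls the output near \<open>p\<close>, finitely many of these neighbourhoods cover the compact
space of tuples, and the largest of their windows works everywhere. Agreement on a window is
transitive, so two tuples near the same \<open>p\<close> can be compared through it. The output window \<open>N\<close> is arbitrary because the
lemma is iterated through nested operations.\<close>

lemma block_operation_uniform:
  assumes X: "subshift S X" and g: "block_operation S X n g"
    and closed: "\<And>xs. xs \<in> tuples X n \<Longrightarrow> g xs \<in> X"
  shows "\<exists>M. \<forall>xs\<in>tuples X n. \<forall>ys\<in>tuples X n.
           (\<forall>j<n. agree M (xs ! j) (ys ! j)) \<longrightarrow> agree N (g xs) (g ys)"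
proof -
  let ?T = "subtopology (full_shift S) X"
  let ?K = "product_topology (\<lambda>_. ?T) {..<n}"
  define G where "G p = g (map p [0..<n])" for p
  have top: "topspace ?K = PiE {..<n} (\<lambda>_. X)"
    using topspace_subshift[OF X] by simp
  have cont: "continuous_map ?K ?T G"
    using g by (simp add: block_operation_def G_def[abs_def])
  have GX: "G p \<in> X" if "p \<in> topspace ?K" for p
  proof -
    have "map p [0..<n] \<in> tuples X n" using that unfolding top by (simp add: tuples_def PiE_iff image_subset_iff)
    then show ?thesis by (simp add: G_def closed)
  qed
  have "\<exists>m. \<forall>q\<in>topspace ?K. (\<forall>j<n. agree m (p j) (q j)) \<longrightarrow> agree N (G p) (G q)"
    if p: "p \<in> topspace ?K" for p
  proof -
    define V where "V = {q \<in> topspace ?K. G q \<in> {y \<in> X. agree N (G p) y}}"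
    have "openin ?K V" unfolding V_def
      by (rule openin_continuous_map_preimage[OF cont window_open[OF X GX[OF p]]])
    moreover have "p \<in> V" using p GX by (simp add: V_def)
    ultimately obtain U where U: "\<forall>j\<in>{..<n}. openin ?T (U j)" "p \<in> PiE {..<n} U"
      "PiE {..<n} U \<subseteq> V"
      unfolding openin_product_topology_alt by blast
    have "\<exists>m. \<forall>y\<in>X. agree m (p j) y \<longrightarrow> y \<in> U j" if "j < n" for j
      using open_contains_window[OF X, of "U j" "p j"] U(1,2) that by (auto simp: PiE_iff)
    then obtain m where m: "\<And>j y. j < n \<Longrightarrow> y \<in> X \<Longrightarrow> agree (m j) (p j) y \<Longrightarrow> y \<in> U j"
      by metis
    obtain M where M: "\<And>j. j < n \<Longrightarrow> m j \<le> M"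
      using finite_nat_set_iff_bounded_le[of "m ` {..<n}"] by auto
    have "agree N (G p) (G q)" if q: "q \<in> topspace ?K" "\<forall>j<n. agree M (p j) (q j)" for q
    proof -
      have "q j \<in> U j" if "j < n" for j
        using m[OF that] M[OF that] q that agree_mono unfolding top by blast
      then have "q \<in> PiE {..<n} U" using q(1) unfolding top by (auto simp: PiE_iff)
      then show ?thesis using U(3) by (auto simp: V_def)
    qed
    then show ?thesis by blast
  qed
  then have "\<forall>p\<in>topspace ?K. \<exists>m. \<forall>q\<in>topspace ?K.
      (\<forall>j<n. agree m (p j) (q j)) \<longrightarrow> agree N (G p) (G q)" by blast
  from bchoice[OF this] obtain m where m: "\<And>p q. p \<in> topspace ?K \<Longrightarrow> q \<in> topspace ?K \<Longrightarrow>
      \<forall>j<n. agree (m p) (p j) (q j) \<Longrightarrow> agree N (G p) (G q)"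
    by blast
  \<comment> \<open>the neighbourhood of \<open>p\<close> on which the window \<open>m p\<close> controls the output\<close>
  define B where "B p = PiE {..<n} (\<lambda>j. {y \<in> X. agree (m p) (p j) y})" for p
  have Bopen: "openin ?K (B p)" if "p \<in> topspace ?K" for p
    using that window_open[OF X] unfolding top B_def by (auto simp: openin_PiE PiE_iff)
  have self: "p \<in> B p" if "p \<in> topspace ?K" for p
    using that unfolding top B_def by (auto simp: PiE_iff)
  have "compact_space ?K"
    using compact_space_subshift[OF X] by (simp add: compact_space_product_topology)
  moreover have "topspace ?K \<subseteq> \<Union>(B ` topspace ?K)" using self by blast
  moreover have "\<forall>U\<in>B ` topspace ?K. openin ?K U" using Bopen by blast
  ultimately obtain \<F> where \<F>: "finite \<F>" "\<F> \<subseteq> B ` topspace ?K" "topspace ?K \<subseteq> \<Union>\<F>"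
    unfolding compact_space_alt by meson
  from finite_subset_image[OF \<F>(1,2)]
  obtain P where P: "finite P" "P \<subseteq> topspace ?K" "topspace ?K \<subseteq> \<Union>(B ` P)"
    using \<F>(3) by blast
  obtain M where M: "\<And>p. p \<in> P \<Longrightarrow> m p \<le> M"
    using finite_nat_set_iff_bounded_le[of "m ` P"] P(1) by auto
  have "agree N (g xs) (g ys)"
    if xs: "xs \<in> tuples X n" and ys: "ys \<in> tuples X n"
      and near: "\<forall>j<n. agree M (xs ! j) (ys ! j)" for xs ys
  proof -
    define p where "p = restrict ((!) xs) {..<n}"
    define q where "q = restrict ((!) ys) {..<n}"
    have "xs ! j \<in> X \<and> ys ! j \<in> X" if "j < n" for j
      using xs ys that nth_mem[of j xs] nth_mem[of j ys] by (auto simp: tuples_def)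
    then have pq: "p \<in> topspace ?K" "q \<in> topspace ?K"
      unfolding top p_def q_def by auto
    have "map p [0..<n] = xs" "map q [0..<n] = ys"
      using xs ys by (auto simp: p_def q_def tuples_def intro!: nth_equalityI)
    then have G: "G p = g xs" "G q = g ys" by (auto simp: G_def)
    obtain c where c: "c \<in> P" "p \<in> B c" using P(3) pq(1) by auto
    have cp: "\<forall>j<n. agree (m c) (c j) (p j)" using c(2) by (auto simp: B_def PiE_iff)
    have "\<forall>j<n. agree (m c) (p j) (q j)"
      using near agree_mono[OF _ M[OF c(1)]] by (auto simp: p_def q_def)
    with cp have cq: "\<forall>j<n. agree (m c) (c j) (q j)" by (metis agree_trans)
    have "c \<in> topspace ?K" using c(1) P(2) by blast
    from m[OF this pq(1) cp] m[OF this pq(2) cq]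
    have "agree N (G p) (G q)" by (metis agree_sym agree_trans)
    then show ?thesis by (simp add: G)
  qed
  then show ?thesis by blast
qed

text \<open>Induction on the depth: the outermost operation dictates the accuracy that is required of its
affine argument. The window does not depend on the constants, since an operation is uniformly
continuous in all arguments jointly, nor on the operation symbols, since there are finitely many.\<close>

lemma bounded_depth_uniform:
  fixes X :: "('f, int \<Rightarrow> 's) algebra"
  assumes fin: "finite (ops \<Omega>)" and X: "algebraic_subshift \<Omega> E S X"
  shows "\<exists>M. \<forall>t\<in>Af \<Omega> X. depth t \<le> k \<longrightarrow>
    (\<forall>x\<in>universe X. \<forall>y\<in>universe X. agree M x y \<longrightarrow> agree N (Eval X t x) (Eval X t y))"
proof (induction k arbitrary: N)
  case 0
  have "agree N (Eval X t x) (Eval X t y)" if "depth t \<le> 0" "agree N x y" for t :: "('f, int \<Rightarrow> 's) affine_map" and x y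
    using that by (cases t) auto
  then show ?case by blast
next
  case (Suc k)
  have sub: "subshift S (universe X)" and alg: "algebra_of \<Omega> X"
    using X by (auto simp: algebraic_subshift_def variety_def)
  have "\<exists>M. \<forall>xs\<in>tuples (universe X) (arity \<Omega> f). \<forall>ys\<in>tuples (universe X) (arity \<Omega> f).
      (\<forall>j<arity \<Omega> f. agree M (xs ! j) (ys ! j)) \<longrightarrow> agree N (oper X f xs) (oper X f ys)"
    if "f \<in> ops \<Omega>" for f
    using that block_operation_uniform[OF sub] X operation_in_universe[OF alg]
    by (auto simp: algebraic_subshift_def)
  then obtain M where M: "\<And>f xs ys. f \<in> ops \<Omega> \<Longrightarrow> xs \<in> tuples (universe X) (arity \<Omega> f) \<Longrightarrow>
      ys \<in> tuples (universe X) (arity \<Omega> f) \<Longrightarrow> \<forall>j<arity \<Omega> f. agree (M f) (xs ! j) (ys ! j) \<Longrightarrow>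
      agree N (oper X f xs) (oper X f ys)"
    by metis
  \<comment> \<open>a common bound exists because there are finitely many operation symbols\<close>
  obtain M' where M': "\<And>f. f \<in> ops \<Omega> \<Longrightarrow> M f \<le> M'"
    using finite_nat_set_iff_bounded_le[of "M ` ops \<Omega>"] fin by auto
  \<comment> \<open>a window for the affine argument; the map \<open>\<xi>\<close> also requires the window \<open>N\<close> itself, whence \<open>max N M''\<close> below\<close>
  obtain M'' where M'': "\<And>t x y. t \<in> Af \<Omega> X \<Longrightarrow> depth t \<le> k \<Longrightarrow> x \<in> universe X \<Longrightarrow>
      y \<in> universe X \<Longrightarrow> agree M'' x y \<Longrightarrow> agree M' (Eval X t x) (Eval X t y)"
    using Suc.IH[of M'] by blast
  have "agree N (Eval X t x) (Eval X t y)"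
    if t: "t \<in> Af \<Omega> X" "depth t \<le> Suc k" and x: "x \<in> universe X" and y: "y \<in> universe X"
      and near: "agree (max N M'') x y" for t x y
    using t(1)
  proof cases
    case Hole
    then show ?thesis using near agree_mono by fastforce
  next
    case (Const a)
    then show ?thesis by simp
  next
    case (Apply f as bs u)
    let ?xs = "as @ [Eval X u x] @ bs" and ?ys = "as @ [Eval X u y] @ bs"
    have "agree M' (Eval X u x) (Eval X u y)"
      using M''[of u x y] Apply t(2) x y agree_mono[OF near, of M''] by simp
    then have "agree (M f) (Eval X u x) (Eval X u y)"
      using M' Apply agree_mono by blast
    then have "\<forall>j<arity \<Omega> f. agree (M f) (?xs ! j) (?ys ! j)"
      by (auto simp: nth_append nth_Cons split: nat.splits)
    moreover have "?xs \<in> tuples (universe X) (arity \<Omega> f)" "?ys \<in> tuples (universe X) (arity \<Omega> f)"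
      using Apply Eval_in_universe[OF alg _ x] Eval_in_universe[OF alg _ y]
      by (auto simp: tuples_def)
    ultimately have "agree N (oper X f ?xs) (oper X f ?ys)"
      using M Apply by blast
    then show ?thesis using Apply by simp
  qed
  then show ?case by blast
qed

section \<open>The action of the integers\<close>

definition shift_by :: "int \<Rightarrow> (int \<Rightarrow> 's) \<Rightarrow> int \<Rightarrow> 's" where
  "shift_by i x = (\<lambda>j. x (j + i))"

lemma shift_by_0 [simp]: "shift_by 0 = id"
  by (auto simp: shift_by_def)

lemma shift_by_Suc: "shift_by (i + 1) x = shift_by i (shift_map x)"
  by (auto simp: shift_by_def shift_map_def algebra_simps)

lemma shift_by_commutes_shift_map: "shift_by i (shift_map x) = shift_map (shift_by i x)"
  by (auto simp: shift_by_def shift_map_def algebra_simps)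

lemma inj_shift_map: "inj shift_map"
proof (rule injI)
  fix x y :: "int \<Rightarrow> 'a" assume "shift_map x = shift_map y"
  then have "x (i - 1 + 1) = y (i - 1 + 1)" for i by (metis shift_map_def)
  then show "x = y" by (auto simp: fun_eq_iff)
qed

text \<open>Negative exponents need \<open>X \<subseteq> shift_map ` X\<close>: a point of \<open>X\<close> has its preimage under the shift in \<open>X\<close>.\<close>

lemma shift_by_in:
  assumes "shift_map ` X = X"
  shows "x \<in> X \<Longrightarrow> shift_by i x \<in> X"
proof (induction i arbitrary: x rule: int_induct[where k = 0])
  case base
  then show ?case by simp
next
  case (step1 i)
  then show ?case using assms by (auto simp: shift_by_Suc)
next
  case (step2 i)
  obtain y where y: "y \<in> X" "x = shift_map y" using assms step2.prems by blast
  then have "shift_by (i - 1) x = shift_by i y"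
    using shift_by_Suc[of "i - 1" y] by simp
  then show ?case using step2.IH y by simp
qed

text \<open>Negative exponents are reached by cancelling the injective map \<open>shift_map\<close>.\<close>

lemma block_operation_shift_by:
  assumes X: "shift_map ` X = X" and g: "block_operation S X n g"
  shows "xs \<in> tuples X n \<Longrightarrow> g (map (shift_by i) xs) = shift_by i (g xs)"
proof (induction i arbitrary: xs rule: int_induct[where k = 0])
  case base
  then show ?case by simp
next
  case (step1 i)
  have "map shift_map xs \<in> tuples X n" by (rule tuples_map[OF _ step1.prems]) (use X in auto)
  then have "g (map (shift_by i) (map shift_map xs)) = shift_by i (g (map shift_map xs))"
    by (rule step1.IH)
  also have "g (map shift_map xs) = shift_map (g xs)"
    using g step1.prems by (simp add: block_operation_def)
  finally show ?case by (simp add: shift_by_Suc comp_def)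
next
  case (step2 i)
  let ?ys = "map (shift_by (i - 1)) xs"
  have shift: "shift_map (shift_by (i - 1) x) = shift_by i x" for x :: "int \<Rightarrow> 'a"
    using shift_by_Suc[of "i - 1" x] shift_by_commutes_shift_map[of "i - 1" x] by simp
  have "?ys \<in> tuples X n" by (rule tuples_map[OF _ step2.prems]) (use shift_by_in[OF X] in auto)
  then have "shift_map (g ?ys) = g (map shift_map ?ys)"
    using g unfolding block_operation_def by metis
  also have "map shift_map ?ys = map (shift_by i) xs"
    by (simp add: shift comp_def)
  also have "g (map (shift_by i) xs) = shift_map (shift_by (i - 1) (g xs))"
    using step2 by (simp add: shift)
  finally show ?case using inj_shift_map by (auto dest: injD)
qed

section \<open>Shallow algebras are cellwise\<close>

text \<open>The kernel of \<open>c\<close> is a congruence. Phrased for a map rather than for an equivalence relation because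
the map then serves as the quotient morphism.\<close>

definition compatible :: "'f signature \<Rightarrow> ('f, 'a) algebra \<Rightarrow> ('a \<Rightarrow> 'b) \<Rightarrow> bool" where
  "compatible \<Omega> A c \<longleftrightarrow> (\<forall>f\<in>ops \<Omega>.
     \<forall>xs\<in>tuples (universe A) (arity \<Omega> f). \<forall>ys\<in>tuples (universe A) (arity \<Omega> f).
       map c xs = map c ys \<longrightarrow> c (oper A f xs) = c (oper A f ys))"

text \<open>Affine maps change one argument at a time. The arguments of an operation can be exchanged one after
another; the list \<open>zs\<close> in the induction holds those already exchanged.\<close>

lemma compatible_if_one_argument:
  assumes "\<And>f as bs x y. f \<in> ops \<Omega> \<Longrightarrow> length as + 1 + length bs = arity \<Omega> f \<Longrightarrow>
      set as \<subseteq> universe A \<Longrightarrow> set bs \<subseteq> universe A \<Longrightarrow> x \<in> universe A \<Longrightarrow> y \<in> universe A \<Longrightarrow>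
      c x = c y \<Longrightarrow> c (oper A f (as @ [x] @ bs)) = c (oper A f (as @ [y] @ bs))"
  shows "compatible \<Omega> A c"
proof -
  have step: "c (oper A f (zs @ xs)) = c (oper A f (zs @ ys))"
    if "f \<in> ops \<Omega>" "map c xs = map c ys" "length (zs @ xs) = arity \<Omega> f"
      "set xs \<subseteq> universe A" "set ys \<subseteq> universe A" "set zs \<subseteq> universe A" for f xs ys zs
    using that(2-)
  proof (induction xs arbitrary: ys zs)
    case Nil
    then show ?case by simp
  next
    case (Cons x xs)
    then obtain y ys' where ys: "ys = y # ys'" "c x = c y" "map c xs = map c ys'" by auto
    have "c (oper A f (zs @ [x] @ xs)) = c (oper A f (zs @ [y] @ xs))"
      using Cons.prems ys that(1) by (intro assms) auto
    also have "\<dots> = c (oper A f (zs @ [y] @ ys'))"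
      using Cons.IH[of ys' "zs @ [y]"] Cons.prems ys by auto
    finally show ?case using ys by simp
  qed
  show ?thesis
    unfolding compatible_def
  proof (intro ballI impI)
    fix f xs ys
    assume "f \<in> ops \<Omega>" "xs \<in> tuples (universe A) (arity \<Omega> f)"
      "ys \<in> tuples (universe A) (arity \<Omega> f)" "map c xs = map c ys"
    then show "c (oper A f xs) = c (oper A f ys)"
      using step[of f xs ys "[]"] by (simp add: tuples_def)
  qed
qed

lemma compatible_comp_inj:
  assumes c: "compatible \<Omega> A c" and e: "inj_on e (c ` universe A)"
  shows "compatible \<Omega> A (e \<circ> c)"
  unfolding compatible_def
proof (intro ballI impI)
  fix f xs ys
  assume f: "f \<in> ops \<Omega>" and xs: "xs \<in> tuples (universe A) (arity \<Omega> f)"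
    and ys: "ys \<in> tuples (universe A) (arity \<Omega> f)" and eq: "map (e \<circ> c) xs = map (e \<circ> c) ys"
  have "map e (map c xs) = map e (map c ys)" using eq by simp
  moreover have "inj_on e (set (map c xs) \<union> set (map c ys))"
    by (rule inj_on_subset[OF e]) (use xs ys in \<open>auto simp: tuples_def\<close>)
  ultimately have "map c xs = map c ys" by (rule map_inj_on)
  then have "c (oper A f xs) = c (oper A f ys)"
    using c f xs ys unfolding compatible_def by blast
  then show "(e \<circ> c) (oper A f xs) = (e \<circ> c) (oper A f ys)" by simp
qed

text \<open>For compatible \<open>c\<close> this is the quotient by the kernel of \<open>c\<close>, with classes named by their values under \<open>c\<close>.\<close>

definition image_algebra :: "('f, 'a) algebra \<Rightarrow> ('a \<Rightarrow> 'b) \<Rightarrow> ('f, 'b) algebra" where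
  "image_algebra A c = \<lparr>universe = c ` universe A,
     oper = (\<lambda>f ys. c (oper A f (map (inv_into (universe A) c) ys)))\<rparr>"

lemma morphism_image_algebra:
  assumes "compatible \<Omega> A c" shows "morphism \<Omega> A (image_algebra A c) c"
  unfolding morphism_def
proof (intro conjI ballI)
  show "c \<in> universe A \<rightarrow> universe (image_algebra A c)" by (auto simp: image_algebra_def)
  fix f xs assume f: "f \<in> ops \<Omega>" and xs: "xs \<in> tuples (universe A) (arity \<Omega> f)"
  let ?g = "inv_into (universe A) c"
  have "map (?g \<circ> c) xs \<in> tuples (universe A) (arity \<Omega> f)"
    by (rule tuples_map[OF _ xs]) (simp add: inv_into_into)
  moreover have "map c (map (?g \<circ> c) xs) = map c xs"
    using xs by (auto simp: tuples_def f_inv_into_f subset_iff)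
  ultimately show "c (oper A f xs) = oper (image_algebra A c) f (map c xs)"
    using assms f xs unfolding compatible_def image_algebra_def by (metis algebra.select_convs(2) map_map)
qed

text \<open>A map determined by a window takes no more values than there are words on that window.\<close>

lemma finite_window_determined:
  assumes X: "subshift S X"
    and m: "\<And>x y. x \<in> X \<Longrightarrow> y \<in> X \<Longrightarrow> agree m x y \<Longrightarrow> h x = h y"
  shows "finite (h ` X)"
proof -
  let ?W = "\<lambda>x. restrict x {- int m..int m}"
  have "?W ` X \<subseteq> {- int m..int m} \<rightarrow>\<^sub>E S" using subshift_values[OF X] by auto
  then have "finite (?W ` X)"
    using X by (rule_tac finite_subset) (auto simp: subshift_def intro!: finite_PiE)
  moreover have "h x = h (inv_into X ?W (?W x))" if "x \<in> X" for x
  proof (rule m[OF that])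
    have "?W x \<in> ?W ` X" using that by blast
    then have W: "?W (inv_into X ?W (?W x)) = ?W x" and "inv_into X ?W (?W x) \<in> X"
      by (rule f_inv_into_f, rule inv_into_into)
    then show "inv_into X ?W (?W x) \<in> X" by simp
    have "inv_into X ?W (?W x) i = x i" if "\<bar>i\<bar> \<le> int m" for i
      using fun_cong[OF W, of i] that by (auto simp: restrict_def split: if_splits)
    then show "agree m x (inv_into X ?W (?W x))" by (simp add: agree_def)
  qed
  then have "h ` X \<subseteq> (h \<circ> inv_into X ?W) ` (?W ` X)" by force
  ultimately show ?thesis using finite_surj by blast
qed

text \<open>The syntactic invariant of a point: equality of profiles is the largest congruence whose classes
determine the central symbol.\<close>

definition profile ::
  "'f signature \<Rightarrow> ('f, int \<Rightarrow> 's) algebra \<Rightarrow> (int \<Rightarrow> 's) \<Rightarrow> ('f, int \<Rightarrow> 's) affine_map \<Rightarrow> 's" where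
  "profile \<Omega> X x = restrict (\<lambda>t. Eval X t x 0) (Af \<Omega> X)"

lemma profile_eq_iff:
  "profile \<Omega> X x = profile \<Omega> X y \<longleftrightarrow> (\<forall>t\<in>Af \<Omega> X. Eval X t x 0 = Eval X t y 0)"
  by (auto simp: profile_def fun_eq_iff)

primrec subst :: "('f, 'a) affine_map \<Rightarrow> ('f, 'a) affine_map \<Rightarrow> ('f, 'a) affine_map" where
  "subst Hole u = u"
| "subst (Const a) u = Const a"
| "subst (Apply f as t bs) u = Apply f as (subst t u) bs"

lemma subst_in_Af: "t \<in> Af \<Omega> A \<Longrightarrow> u \<in> Af \<Omega> A \<Longrightarrow> subst t u \<in> Af \<Omega> A"
  by (induction rule: Af.induct) (auto intro: Af.intros)

lemma Eval_subst: "Eval A (subst t u) x = Eval A t (Eval A u x)"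
  by (induction t) auto

text \<open>If a context \<open>t\<close> could separate two values of an operation, then \<open>t\<close> filled with that operation would
be an affine map separating the arguments.\<close>

lemma profile_compatible: "compatible \<Omega> X (profile \<Omega> X)"
proof (rule compatible_if_one_argument)
  fix f as bs x y
  assume f: "f \<in> ops \<Omega>" "length as + 1 + length bs = arity \<Omega> f"
    "set as \<subseteq> universe X" "set bs \<subseteq> universe X"
    and xy: "profile \<Omega> X x = profile \<Omega> X y"
  have u: "Apply f as Hole bs \<in> Af \<Omega> X" using f by (intro Af.intros)
  have "Eval X t (oper X f (as @ [x] @ bs)) 0 = Eval X t (oper X f (as @ [y] @ bs)) 0"
    if "t \<in> Af \<Omega> X" for t
    using xy subst_in_Af[OF that u] Eval_subst[of X t "Apply f as Hole bs"]
    unfolding profile_eq_iff by auto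
  then show "profile \<Omega> X (oper X f (as @ [x] @ bs)) = profile \<Omega> X (oper X f (as @ [y] @ bs))"
    by (simp add: profile_eq_iff)
qed

text \<open>A higher block presentation adapted to the algebra: the cell \<open>i\<close> of the new configuration stores the
code of the shifted point. The window makes the alphabet finite and the map continuous, the
central symbol makes it injective, and compatibility makes it a morphism for the cellwise operations.\<close>

lemma cellwise_if_compatible_code:
  fixes X :: "('f, int \<Rightarrow> 's) algebra" and c :: "(int \<Rightarrow> 's) \<Rightarrow> nat"
  assumes id: "identities \<Omega> E" and X: "algebraic_subshift \<Omega> E S X"
    and comp: "compatible \<Omega> X c"
    and m: "\<And>x y. x \<in> universe X \<Longrightarrow> y \<in> universe X \<Longrightarrow> agree m x y \<Longrightarrow> c x = c y"
    and centre: "\<And>x y. x \<in> universe X \<Longrightarrow> y \<in> universe X \<Longrightarrow> c x = c y \<Longrightarrow> x 0 = y 0"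
  shows "cellwise_up_to_conjugacy \<Omega> E S X"
proof -
  let ?X = "universe X"
  have sub: "subshift S ?X" and var: "X \<in> variety \<Omega> E" and alg: "algebra_of \<Omega> X"
    and block: "\<And>f. f \<in> ops \<Omega> \<Longrightarrow> block_operation S ?X (arity \<Omega> f) (oper X f)"
    using X by (auto simp: algebraic_subshift_def variety_def)
  have shift: "shift_map ` ?X = ?X" using sub by (simp add: subshift_def)
  define R where "R = image_algebra X c"
  have UR: "universe R = c ` ?X" by (simp add: R_def image_algebra_def)
  have mor: "morphism \<Omega> X R c" unfolding R_def by (rule morphism_image_algebra[OF comp])
  define \<phi> where "\<phi> x = (\<lambda>i. c (shift_by i x))" for x
  define Y where "Y = \<lparr>universe = \<phi> ` ?X, oper = oper (cellwise R)\<rparr>"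
  have \<phi>R: "\<phi> x i \<in> universe R" if "x \<in> ?X" for x i
    using shift_by_in[OF shift that] by (auto simp: \<phi>_def UR)
  have \<phi>_oper: "\<phi> (oper X f xs) = oper (cellwise R) f (map \<phi> xs)"
    if f: "f \<in> ops \<Omega>" and xs: "xs \<in> tuples ?X (arity \<Omega> f)" for f xs
  proof
    fix i
    have "map (shift_by i) xs \<in> tuples ?X (arity \<Omega> f)"
      by (rule tuples_map[OF _ xs]) (use shift_by_in[OF shift] in auto)
    then have "c (oper X f (map (shift_by i) xs)) = oper R f (map c (map (shift_by i) xs))"
      using mor f by (auto simp: morphism_def)
    then show "\<phi> (oper X f xs) i = oper (cellwise R) f (map \<phi> xs) i"
      using block_operation_shift_by[OF shift block[OF f] xs]
      by (simp add: \<phi>_def cellwise_def comp_def)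
  qed
  have \<phi>_shift: "\<phi> (shift_map x) = shift_map (\<phi> x)" for x
    by (auto simp: \<phi>_def shift_map_def shift_by_def algebra_simps)
  have inj: "inj_on \<phi> ?X"
  proof (rule inj_onI)
    fix x y assume xy: "x \<in> ?X" "y \<in> ?X" "\<phi> x = \<phi> y"
    show "x = y"
    proof
      fix i
      have "c (shift_by i x) = c (shift_by i y)" using xy(3) by (auto simp: \<phi>_def fun_eq_iff)
      then show "x i = y i"
        using centre[OF shift_by_in[OF shift xy(1)] shift_by_in[OF shift xy(2)]]
        by (simp add: shift_by_def)
    qed
  qed
  have comp_cont: "continuous_map (subtopology (full_shift S) ?X) (discrete_topology (universe R)) (\<lambda>x. \<phi> x i)" for i
  proof (rule continuous_map_window_determined[OF sub])
    show "(\<lambda>x. \<phi> x i) \<in> ?X \<rightarrow> universe R" using \<phi>R by auto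
    \<comment> \<open>this window contains the window \<open>m\<close> around the cell \<open>i\<close>\<close>
    fix x y assume "x \<in> ?X" "y \<in> ?X" "agree (m + nat \<bar>i\<bar>) x y"
    moreover from this have "agree m (shift_by i x) (shift_by i y)"
      by (auto simp: agree_def shift_by_def)
    ultimately show "\<phi> x i = \<phi> y i"
      unfolding \<phi>_def by (intro m shift_by_in[OF shift])
  qed
  then have cont: "continuous_map (subtopology (full_shift S) ?X) (full_shift (universe R)) \<phi>"
    by (simp add: full_shift_def continuous_map_componentwise_UNIV)
  \<comment> \<open>the image is closed, being compact in a Hausdorff space\<close>
  have "compactin (full_shift (universe R)) (\<phi> ` ?X)"
    using image_compactin[OF _ cont, of ?X] compact_space_subshift[OF sub] topspace_subshift[OF sub]
    by (simp add: compact_space_def)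
  moreover have "Hausdorff_space (full_shift (universe R))"
    by (simp add: full_shift_def Hausdorff_space_product_topology)
  ultimately have closed: "closedin (full_shift (universe R)) (\<phi> ` ?X)"
    by (rule compactin_imp_closedin[rotated])
  have "finite (universe R)"
    unfolding UR by (rule finite_window_determined[OF sub m])
  moreover have "shift_map ` \<phi> ` ?X = \<phi> ` ?X"
    using shift \<phi>_shift by (metis (no_types, lifting) image_cong image_image)
  ultimately have "subshift (universe R) (universe Y)"
    using closed by (simp add: subshift_def Y_def)
  moreover have "R \<in> variety \<Omega> E"
    using variety_surjective_image[OF id var mor] UR by simp
  moreover have "subalgebra \<Omega> (cellwise R) (universe Y)"
    unfolding subalgebra_def
  proof (intro conjI ballI)
    show "universe Y \<subseteq> universe (cellwise R)" using \<phi>R by (auto simp: Y_def cellwise_def)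
    fix f ys assume f: "f \<in> ops \<Omega>" and ys: "ys \<in> tuples (universe Y) (arity \<Omega> f)"
    then have "ys \<in> lists (\<phi> ` ?X)" by (auto simp: tuples_def Y_def)
    then obtain xs where xs: "ys = map \<phi> xs" "set xs \<subseteq> ?X"
      unfolding lists_image by auto
    then have "xs \<in> tuples ?X (arity \<Omega> f)" using ys by (auto simp: tuples_def)
    then show "oper (cellwise R) f ys \<in> universe Y"
      using \<phi>_oper[OF f, of xs] imageI[OF operation_in_universe[OF alg f, of xs], of \<phi>] xs(1)
      by (simp add: Y_def)
  qed
  ultimately have "cellwise_subshift \<Omega> E R Y"
    using \<open>finite (universe R)\<close> by (simp add: cellwise_subshift_def Y_def)
  moreover have "algebraic_conjugacy \<Omega> S X (universe R) Y \<phi>"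
    using cont inj \<phi>_shift \<phi>_oper
    by (auto simp: algebraic_conjugacy_def block_map_def morphism_def bij_betw_def Y_def
        continuous_map_in_subtopology)
  ultimately show ?thesis unfolding cellwise_up_to_conjugacy_def by blast
qed

text \<open>By shallowness a window common to the affine maps of depth at most \<open>k\<close> serves all affine maps, so it
determines the profile; the finitely many profiles can then be numbered.\<close>

lemma shallow_imp_cellwise:
  fixes X :: "('f, int \<Rightarrow> 's) algebra"
  assumes id: "identities \<Omega> E" and X: "algebraic_subshift \<Omega> E S X"
    and fin: "finite (ops \<Omega>)" and k: "shallow \<Omega> k X"
  shows "cellwise_up_to_conjugacy \<Omega> E S X"
proof -
  have sub: "subshift S (universe X)" using X by (simp add: algebraic_subshift_def)
  obtain m where m: "\<And>t x y. t \<in> Af \<Omega> X \<Longrightarrow> depth t \<le> k \<Longrightarrow> x \<in> universe X \<Longrightarrow>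
      y \<in> universe X \<Longrightarrow> agree m x y \<Longrightarrow> agree 0 (Eval X t x) (Eval X t y)"
    using bounded_depth_uniform[OF fin X, of k 0] by blast
  have window: "profile \<Omega> X x = profile \<Omega> X y"
    if xy: "x \<in> universe X" "y \<in> universe X" "agree m x y" for x y
    unfolding profile_eq_iff
  proof
    fix t assume "t \<in> Af \<Omega> X"
    then obtain t' where t': "t' \<in> Af \<Omega> X" "depth t' \<le> k"
      "\<forall>x\<in>universe X. Eval X t x = Eval X t' x"
      using k unfolding shallow_def by blast
    have "Eval X t' x 0 = Eval X t' y 0" using m[OF t'(1,2) xy] by (simp add: agree_def)
    then show "Eval X t x 0 = Eval X t y 0" using t'(3) xy by simp
  qed
  have "finite (profile \<Omega> X ` universe X)"
    by (rule finite_window_determined[OF sub window])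
  from finite_imp_inj_to_nat_seg[OF this]
  obtain e :: "_ \<Rightarrow> nat" where e: "inj_on e (profile \<Omega> X ` universe X)" by blast
  define c where "c = e \<circ> profile \<Omega> X"
  have c: "c x = c y \<longleftrightarrow> profile \<Omega> X x = profile \<Omega> X y"
    if "x \<in> universe X" "y \<in> universe X" for x y
    using e that by (auto simp: c_def inj_on_def)
  have "compatible \<Omega> X c"
    unfolding c_def by (rule compatible_comp_inj[OF profile_compatible e])
  then show ?thesis
  proof (rule cellwise_if_compatible_code[OF id X])
    fix x y assume xy: "x \<in> universe X" "y \<in> universe X"
    show "c x = c y" if "agree m x y" using window[OF xy that] c[OF xy] by simp
    show "x 0 = y 0" if "c x = c y"
      using that c[OF xy] Af.Hole[of \<Omega> X] unfolding profile_eq_iff by force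
  qed
qed

theorem theorem3:
  fixes \<Omega> :: "'f signature"
    and E :: "('f trm \<times> 'f trm) set"
    and S :: "'s set"
    and X :: "('f, int \<Rightarrow> 's) algebra"
  assumes "identities \<Omega> E"
    and "finite S"
    and "algebraic_subshift \<Omega> E S X"
  shows "(finite (ops \<Omega>) \<longrightarrow> (\<exists>k. shallow \<Omega> k X) \<longrightarrow> cellwise_up_to_conjugacy \<Omega> E S X) \<and>
    ((\<exists>(R :: ('f, 'r) algebra) \<phi>. R \<in> variety \<Omega> E \<and> finite (universe R) \<and>
        algebraic_conjugacy \<Omega> S X (universe R) (cellwise R) \<phi>) \<longrightarrow> (\<exists>k. shallow \<Omega> k X))"
proof (intro conjI impI)
  assume "finite (ops \<Omega>)" "\<exists>k. shallow \<Omega> k X"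
  then show "cellwise_up_to_conjugacy \<Omega> E S X"
    using shallow_imp_cellwise[OF assms(1,3)] by blast
next
  assume "\<exists>(R :: ('f, 'r) algebra) \<phi>. R \<in> variety \<Omega> E \<and> finite (universe R) \<and>
        algebraic_conjugacy \<Omega> S X (universe R) (cellwise R) \<phi>"
  then obtain R :: "('f, 'r) algebra" and \<phi> where R: "R \<in> variety \<Omega> E" "finite (universe R)"
    and \<phi>: "morphism \<Omega> X (cellwise R) \<phi>" "bij_betw \<phi> (universe X) (universe (cellwise R))"
    by (auto simp: algebraic_conjugacy_def)
  have alg: "algebra_of \<Omega> X" "algebra_of \<Omega> R"
    using assms(3) R by (auto simp: algebraic_subshift_def variety_def)
  obtain k where "shallow \<Omega> k (cellwise R)" using cellwise_shallow[OF alg(2) R(2)] by blast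
  then show "\<exists>k. shallow \<Omega> k X"
    using shallow_if_isomorphic[OF alg(1) algebra_of_cellwise[OF alg(2)] \<phi>] by blast
qed

end
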